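(* For any action-deterministic APECAs $\mathcal{E}_1,\mathcal{E}_2$ over the same set of actions and atomic propositions, $[\![\mathcal{E}_1\wedge\mathcal{E}_2]\!]\subseteq[\![\mathcal{E}_1]\!]\cap[\![\mathcal{E}_2]\!]$.
   Context: Basics. $\mathit{Dist}(S)$: discrete probability distributions on $S$. $\mathbb{B}_3=\{\bot,?,\top\}$ with $\bot<?<\top$ and join $\sqcup$. For a finite clock set $X$: valuations $v:X\to\mathbb{R}_{\ge0}$, resets $v[Y:=0]$, zero valuation $\overline0$; guards are finite conjunctions of atoms $x\sim c$ ($c\in\mathbb{R}_{\ge0}$); $CC(X)$ is the set of guards; regions are sets of valuations satisfying the same guards with constants up to the maximal constant; $\mathit{Succ}(\theta)$ is the union of regions reachable from $\theta$ by time elapse. A probability constraint $\varphi$ over $S$ denotes $\mathit{Sat}(\varphi)\subseteq\mathit{Dist}(S)$; $PC(S)$ is the set of constraints. $\mu\Subset_R\mu'$ for $R\subseteq S\times S'$ iff some $\delta:S\to(S'\to[0,1])$ has $\delta(s)\in\mathit{Dist}(S')$ when $\mu(s)>0$, $\mu'(s')=\sum_s\mu(s)\delta(s)(s')$, and $\delta(s)(s')>0\Rightarrow(s,s')\in R$. APTAs and implementations. An APTA is $(L,A,X,AP,V,T,l_0)$ with $V:L\to2^{2^{AP}}$, $T:L\times CC(X)\times A\times PC(2^X\times L)\to\mathbb{B}_3$ (must: $\top$, may: $?$, $\rightsquigarrow$: $\neq\bot$). A PTA is $(L,A,X,AP,V,T,l_0)$ with $V:L\to2^{AP}$, $T:L\times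 CC(X)\times A\times\mathit{Dist}(2^X\times L)\to\{\bot,\top\}$. The region automaton of a PTA/APTA has states $(l,\theta)$ reachable from $(l_0,\overline0)$, where an edge with guard $g$ is taken in any region $\theta''\subseteq\mathit{Succ}(\theta)\cap g$, leading with probability $\mu(l',Y)$ to $(l',\theta''[Y:=0])$. A PTA is in normal form iff it is isomorphic to the PTA read off its region automaton (locations = reachable region states, guards = regions). A PTA $\mathcal{M}$ in normal form satisfies an APTA $\mathcal{A}$ iff some $R\subseteq L_\mathcal{M}\times L_\mathcal{A}$ relating initial locations satisfies for $(l,l')\in R$: (1) for each must-edge $l'\xrightarrow{g,a}\varphi'$ and region $\theta$ with $(l,\theta)$ and $(l',\theta)$ reachable in the respective region automata, there are edges $l\xrightarrow{g_i,a}\mu_i$ ($1\le i\le n$) with $\mathit{Succ}(\theta)\cap g\subseteq\mathit{Succ}(\theta)\cap\bigcup_i g_i$ and $\mu_i\Subset_R\mu_i'$ for some $\mu_i'\in\mathit{Sat}(\varphi')$; (2) for each edge $l\xrightarrow{g,a}\mu$ there is $l'\rightsquigarrow^{g',a}\varphi'$ with $g\subseteq g'$ and $\mu\Subset_R\mu'$ for some $\mu'\in\mathit{Sat}(\varphi')$; (3) $V(l)\in V'(l')$; here $\Subset_R$ relates $(Y,l)$ with $(Y,l')$ for $(l,l')\in R$. $[\![\mathcal{A}]\!]$ is the set of such PTAs. APECA. An APECA is $\mathcal{E}=(L,A,X_A,AP,V,T,l_0)$ with $X_A=\{x_a:a\in A\}$, $V:L\to2^{2^{AP}}$, $T:L\times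 CC(X_A)\times A\times PC(L)\to\mathbb{B}_3$, such that for all $l,a$ the disjunction of guards $g$ with some $T(l,g,a,\varphi)\neq\bot$ is $\mathit{true}$. An $a$-edge resets exactly $x_a$: $\mathcal{E}$ is viewed as the APTA in which $\varphi$ on an $a$-edge becomes the constraint with distributions $\hat\mu(\{x_a\},l')=\mu(l')$, $\mu\in\mathit{Sat}(\varphi)$; $[\![\mathcal{E}]\!]$ is taken for this APTA. $\mathcal{E}$ is action-deterministic iff in its region automaton two edges from a reachable state with the same action and different constraints have disjoint regions. Conjunction. For action-deterministic $\mathcal{E}_i=(L_i,A,X_A,AP,V_i,T_i,l_0^i)$: $\mathcal{E}_1\wedge\mathcal{E}_2=(L_1\times L_2,A,X_A,AP,V_\wedge,T_\wedge,\langle l_0^1,l_0^2\rangle)$, $V_\wedge(\langle l_1,l_2\rangle)=V_1(l_1)\cap V_2(l_2)$; whenever $T_1(l_1,g_1,a,\varphi_1)\neq\bot$ and $T_2(l_2,g_2,a,\varphi_2)\neq\bot$, $T_\wedge(\langle l_1,l_2\rangle,g_1\wedge g_2,a,\varphi_\wedge)=T_1(l_1,g_1,a,\varphi_1)\sqcup T_2(l_2,g_2,a,\varphi_2)$ with $\mu_\wedge\in\mathit{Sat}(\varphi_\wedge)$ iff its marginal on $L_1$ is in $\mathit{Sat}(\varphi_1)$ and its marginal on $L_2$ is in $\mathit{Sat}(\varphi_2)$; all other values are $\bot$. *)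

theory Defs
  imports "HOL-Probability.Probability"
begin

text \<open>\<open>\<bool>\<^sub>3\<close>, ordered \<open>BBot < BUnk < BTop\<close>; the join is \<^const>\<open>max\<close>.\<close>

datatype b3 = BBot | BUnk | BTop

fun b3_rank :: "b3 \<Rightarrow> nat" where
  "b3_rank BBot = 0"
| "b3_rank BUnk = 1"
| "b3_rank BTop = 2"

instantiation b3 :: linorder
begin

definition less_eq_b3 :: "b3 \<Rightarrow> b3 \<Rightarrow> bool" where
  "less_eq_b3 x y \<longleftrightarrow> b3_rank x \<le> b3_rank y"

definition less_b3 :: "b3 \<Rightarrow> b3 \<Rightarrow> bool" where
  "less_b3 x y \<longleftrightarrow> b3_rank x < b3_rank y"

instance
proof
  fix x y :: b3
  show "x \<le> y \<Longrightarrow> y \<le> x \<Longrightarrow> x = y"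
    by (cases x; cases y) (simp_all add: less_eq_b3_def)
qed (auto simp: less_eq_b3_def less_b3_def)

end

instance b3 :: finite
proof
  have "(UNIV :: b3 set) = {BBot, BUnk, BTop}"
    using b3.exhaust by auto
  then show "finite (UNIV :: b3 set)"
    by (metis finite.emptyI finite.insertI)
qed


subsection \<open>Distributions and their lifting along a relation\<close>

text \<open>A probability constraint \<open>\<phi>\<close> over \<open>S\<close> is identified with \<open>Sat \<phi> \<subseteq> Dist S\<close>.\<close>

definition Dist :: "'s set \<Rightarrow> 's pmf set" where
  "Dist S = {\<mu>. set_pmf \<mu> \<subseteq> S}"

definition dist_lift ::
  "'s set \<Rightarrow> 't set \<Rightarrow> ('s \<times> 't) set \<Rightarrow> 's pmf \<Rightarrow> 't pmf \<Rightarrow> bool" where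
  "dist_lift S S' R \<mu> \<mu>' \<longleftrightarrow>
     (\<exists>\<delta> :: 's \<Rightarrow> 't \<Rightarrow> real.
        (\<forall>s\<in>S. \<forall>s'\<in>S'. 0 \<le> \<delta> s s' \<and> \<delta> s s' \<le> 1) \<and>
        (\<forall>s\<in>S. pmf \<mu> s > 0 \<longrightarrow> (\<exists>p\<in>Dist S'. \<forall>s'\<in>S'. \<delta> s s' = pmf p s')) \<and>
        (\<forall>s'\<in>S'. pmf \<mu>' s' = (\<Sum>\<^sub>\<infinity>s\<in>S. pmf \<mu> s * \<delta> s s')) \<and>
        (\<forall>s\<in>S. \<forall>s'\<in>S'. \<delta> s s' > 0 \<longrightarrow> (s, s') \<in> R))"


subsection \<open>Clocks, guards and regions\<close>

definition valuations :: "'c set \<Rightarrow> ('c \<Rightarrow> real) set" where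
  "valuations X = X \<rightarrow>\<^sub>E {0..}"

definition zero_val :: "'c set \<Rightarrow> 'c \<Rightarrow> real" where
  "zero_val X = (\<lambda>x\<in>X. 0)"

definition delay :: "'c set \<Rightarrow> ('c \<Rightarrow> real) \<Rightarrow> real \<Rightarrow> 'c \<Rightarrow> real" where
  "delay X v t = (\<lambda>x\<in>X. v x + t)"

definition reset :: "'c set \<Rightarrow> 'c set \<Rightarrow> ('c \<Rightarrow> real) \<Rightarrow> 'c \<Rightarrow> real" where
  "reset X Y v = (\<lambda>x\<in>X. if x \<in> Y then 0 else v x)"

datatype cmp = Lt | Le | Eq | Ge | Gt

fun cmp_sem :: "cmp \<Rightarrow> real \<Rightarrow> real \<Rightarrow> bool" where
  "cmp_sem Lt r c \<longleftrightarrow> r < c"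
| "cmp_sem Le r c \<longleftrightarrow> r \<le> c"
| "cmp_sem Eq r c \<longleftrightarrow> r = c"
| "cmp_sem Ge r c \<longleftrightarrow> r \<ge> c"
| "cmp_sem Gt r c \<longleftrightarrow> r > c"

datatype 'c guard = GTrue | GAtom 'c cmp real | GAnd "'c guard" "'c guard"

fun guard_clocks :: "'c guard \<Rightarrow> 'c set" where
  "guard_clocks GTrue = {}"
| "guard_clocks (GAtom x _ _) = {x}"
| "guard_clocks (GAnd g h) = guard_clocks g \<union> guard_clocks h"

fun guard_consts :: "'c guard \<Rightarrow> real set" where
  "guard_consts GTrue = {}"
| "guard_consts (GAtom _ _ c) = {c}"
| "guard_consts (GAnd g h) = guard_consts g \<union> guard_consts h"

fun guard_sat :: "('c \<Rightarrow> real) \<Rightarrow> 'c guard \<Rightarrow> bool" where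
  "guard_sat v GTrue \<longleftrightarrow> True"
| "guard_sat v (GAtom x r c) \<longleftrightarrow> cmp_sem r (v x) c"
| "guard_sat v (GAnd g h) \<longleftrightarrow> guard_sat v g \<and> guard_sat v h"

definition guard_sem :: "'c set \<Rightarrow> 'c guard \<Rightarrow> ('c \<Rightarrow> real) set" where
  "guard_sem X g = {v \<in> valuations X. guard_sat v g}"

text \<open>
  Throughout, \<open>C\<close> is the set of clock constants up to the maximal constant. It is common to all
  automata under consideration, since the satisfaction relation compares regions of two automata.
  For integer constants it is \<open>{0, 1, \<dots>, K}\<close>.
\<close>

definition CC :: "real set \<Rightarrow> 'c set \<Rightarrow> 'c guard set" where
  "CC C X = {g. guard_clocks g \<subseteq> X \<and> guard_consts g \<subseteq> C}"

definition region_of :: "real set \<Rightarrow> 'c set \<Rightarrow> ('c \<Rightarrow> real) \<Rightarrow> ('c \<Rightarrow> real) set" where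
  "region_of C X v = {w \<in> valuations X. \<forall>g\<in>CC C X. guard_sat w g \<longleftrightarrow> guard_sat v g}"

definition regions :: "real set \<Rightarrow> 'c set \<Rightarrow> ('c \<Rightarrow> real) set set" where
  "regions C X = region_of C X ` valuations X"

definition Succ :: "real set \<Rightarrow> 'c set \<Rightarrow> ('c \<Rightarrow> real) set \<Rightarrow> ('c \<Rightarrow> real) set" where
  "Succ C X \<theta> = \<Union>{\<theta>' \<in> regions C X. \<exists>v\<in>\<theta>. \<exists>t\<ge>0. delay X v t \<in> \<theta>'}"

text \<open>
  Reachable states of the region automaton generated by the edges
  \<open>E l g a \<mu>\<close> (location, guard, action, distribution over resets and target locations).
\<close>

inductive_set region_reach ::
  "real set \<Rightarrow> 'c set \<Rightarrow> ('l \<Rightarrow> 'c guard \<Rightarrow> 'a \<Rightarrow> ('c set \<times> 'l) pmf \<Rightarrow> bool) \<Rightarrow> 'l \<Rightarrow>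
   ('l \<times> ('c \<Rightarrow> real) set) set"
  for C X E l0 where
  init: "(l0, region_of C X (zero_val X)) \<in> region_reach C X E l0"
| step: "\<lbrakk>(l, \<theta>) \<in> region_reach C X E l0; E l g a \<mu>; \<theta>'' \<in> regions C X;
          \<theta>'' \<subseteq> Succ C X \<theta> \<inter> guard_sem X g; (Y, l') \<in> set_pmf \<mu>\<rbrakk>
         \<Longrightarrow> (l', reset X Y ` \<theta>'') \<in> region_reach C X E l0"


subsection \<open>Probabilistic timed automata and normal form\<close>

record ('l, 'a, 'c, 'p) pta =
  pta_locs :: "'l set"
  pta_acts :: "'a set"
  pta_clocks :: "'c set"
  pta_props :: "'p set"
  pta_lab :: "'l \<Rightarrow> 'p set"
  pta_trans :: "'l \<Rightarrow> 'c guard \<Rightarrow> 'a \<Rightarrow> ('c set \<times> 'l) pmf \<Rightarrow> bool"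
  pta_init :: "'l"

definition is_pta :: "real set \<Rightarrow> ('l, 'a, 'c, 'p) pta \<Rightarrow> bool" where
  "is_pta C M \<longleftrightarrow>
     finite (pta_clocks M) \<and>
     pta_init M \<in> pta_locs M \<and>
     (\<forall>l\<in>pta_locs M. pta_lab M l \<subseteq> pta_props M) \<and>
     (\<forall>l g a \<mu>. pta_trans M l g a \<mu> \<longrightarrow>
        l \<in> pta_locs M \<and> g \<in> CC C (pta_clocks M) \<and> a \<in> pta_acts M \<and>
        \<mu> \<in> Dist (Pow (pta_clocks M) \<times> pta_locs M))"

definition pta_reach :: "real set \<Rightarrow> ('l, 'a, 'c, 'p) pta \<Rightarrow> ('l \<times> ('c \<Rightarrow> real) set) set" where
  "pta_reach C M = region_reach C (pta_clocks M) (pta_trans M) (pta_init M)"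

text \<open>
  The PTA read off the region automaton. Its guards are the regions; as guards are syntactic, every
  guard denoting the region is admitted, and \<open>pta_iso\<close> identifies equivalent guards.
\<close>

definition region_pta ::
  "real set \<Rightarrow> ('l, 'a, 'c, 'p) pta \<Rightarrow> ('l \<times> ('c \<Rightarrow> real) set, 'a, 'c, 'p) pta" where
  "region_pta C M =
     \<lparr>pta_locs = pta_reach C M,
      pta_acts = pta_acts M,
      pta_clocks = pta_clocks M,
      pta_props = pta_props M,
      pta_lab = (\<lambda>(l, \<theta>). pta_lab M l),
      pta_trans = (\<lambda>(l, \<theta>) h a \<mu>'.
        (l, \<theta>) \<in> pta_reach C M \<and> h \<in> CC C (pta_clocks M) \<and>
        (\<exists>g \<mu> \<theta>''. pta_trans M l g a \<mu> \<and> \<theta>'' \<in> regions C (pta_clocks M) \<and>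
           \<theta>'' \<subseteq> Succ C (pta_clocks M) \<theta> \<inter> guard_sem (pta_clocks M) g \<and>
           guard_sem (pta_clocks M) h = \<theta>'' \<and>
           \<mu>' = map_pmf (\<lambda>(Y, l'). (Y, (l', reset (pta_clocks M) Y ` \<theta>''))) \<mu>)),
      pta_init = (pta_init M, region_of C (pta_clocks M) (zero_val (pta_clocks M)))\<rparr>"

definition pta_iso :: "('l, 'a, 'c, 'p) pta \<Rightarrow> ('k, 'a, 'c, 'p) pta \<Rightarrow> bool" where
  "pta_iso M N \<longleftrightarrow>
     pta_acts M = pta_acts N \<and> pta_clocks M = pta_clocks N \<and> pta_props M = pta_props N \<and>
     (\<exists>f. bij_betw f (pta_locs M) (pta_locs N) \<and>
        f (pta_init M) = pta_init N \<and>
        (\<forall>l\<in>pta_locs M. pta_lab N (f l) = pta_lab M l) \<and>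
        (\<forall>l\<in>pta_locs M. \<forall>a\<in>pta_acts M. \<forall>\<mu>\<in>Dist (Pow (pta_clocks M) \<times> pta_locs M). \<forall>Z.
           (\<exists>g. pta_trans M l g a \<mu> \<and> guard_sem (pta_clocks M) g = Z) \<longleftrightarrow>
           (\<exists>h. pta_trans N (f l) h a (map_pmf (map_prod id f) \<mu>) \<and>
                guard_sem (pta_clocks N) h = Z)))"

definition normal_form :: "real set \<Rightarrow> ('l, 'a, 'c, 'p) pta \<Rightarrow> bool" where
  "normal_form C M \<longleftrightarrow> pta_iso M (region_pta C M)"


subsection \<open>Abstract probabilistic timed automata and their implementations\<close>

record ('l, 'a, 'c, 'p) apta =
  apta_locs :: "'l set"
  apta_acts :: "'a set"
  apta_clocks :: "'c set"
  apta_props :: "'p set"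
  apta_lab :: "'l \<Rightarrow> 'p set set"
  apta_trans :: "'l \<Rightarrow> 'c guard \<Rightarrow> 'a \<Rightarrow> ('c set \<times> 'l) pmf set \<Rightarrow> b3"
  apta_init :: "'l"

definition apta_reach :: "real set \<Rightarrow> ('l, 'a, 'c, 'p) apta \<Rightarrow> ('l \<times> ('c \<Rightarrow> real) set) set" where
  "apta_reach C A =
     region_reach C (apta_clocks A)
       (\<lambda>l g a \<mu>. \<exists>\<phi>. apta_trans A l g a \<phi> \<noteq> BBot \<and> \<mu> \<in> \<phi>) (apta_init A)"

text \<open>\<open>\<mu> \<Subset>\<^sub>R \<mu>'\<close> for distributions over resets and locations; \<open>R\<close> is extended by equality of resets.\<close>

definition edge_lift ::
  "('m, 'a, 'c, 'p) pta \<Rightarrow> ('l, 'a, 'c, 'p) apta \<Rightarrow> ('m \<times> 'l) set \<Rightarrow>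
   ('c set \<times> 'm) pmf \<Rightarrow> ('c set \<times> 'l) pmf \<Rightarrow> bool" where
  "edge_lift M A R =
     dist_lift (Pow (pta_clocks M) \<times> pta_locs M) (Pow (apta_clocks A) \<times> apta_locs A)
       {((Y, l), (Y', l')). Y = Y' \<and> (l, l') \<in> R}"

definition sat_relation ::
  "real set \<Rightarrow> ('m, 'a, 'c, 'p) pta \<Rightarrow> ('l, 'a, 'c, 'p) apta \<Rightarrow> ('m \<times> 'l) set \<Rightarrow> bool" where
  "sat_relation C M A R \<longleftrightarrow>
     R \<subseteq> pta_locs M \<times> apta_locs A \<and>
     (\<forall>(l, l')\<in>R.
        (\<forall>g a \<phi>'. apta_trans A l' g a \<phi>' = BTop \<longrightarrow>
           (\<forall>\<theta>. (l, \<theta>) \<in> pta_reach C M \<and> (l', \<theta>) \<in> apta_reach C A \<longrightarrow>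
              (\<exists>I. finite I \<and>
                 (\<forall>(h, \<mu>)\<in>I. pta_trans M l h a \<mu> \<and> (\<exists>\<mu>'\<in>\<phi>'. edge_lift M A R \<mu> \<mu>')) \<and>
                 Succ C (apta_clocks A) \<theta> \<inter> guard_sem (apta_clocks A) g
                   \<subseteq> Succ C (apta_clocks A) \<theta> \<inter> (\<Union>(h, \<mu>)\<in>I. guard_sem (pta_clocks M) h)))) \<and>
        (\<forall>g a \<mu>. pta_trans M l g a \<mu> \<longrightarrow>
           (\<exists>g' \<phi>'. apta_trans A l' g' a \<phi>' \<noteq> BBot \<and>
              guard_sem (pta_clocks M) g \<subseteq> guard_sem (apta_clocks A) g' \<and>
              (\<exists>\<mu>'\<in>\<phi>'. edge_lift M A R \<mu> \<mu>'))) \<and>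
        pta_lab M l \<in> apta_lab A l')"

definition pta_satisfies ::
  "real set \<Rightarrow> ('m, 'a, 'c, 'p) pta \<Rightarrow> ('l, 'a, 'c, 'p) apta \<Rightarrow> bool" where
  "pta_satisfies C M A \<longleftrightarrow>
     (\<exists>R. (pta_init M, apta_init A) \<in> R \<and> sat_relation C M A R)"

definition implementations ::
  "real set \<Rightarrow> ('l, 'a, 'c, 'p) apta \<Rightarrow> ('m, 'a, 'c, 'p) pta set" where
  "implementations C A =
     {M. is_pta C M \<and> normal_form C M \<and>
         pta_acts M = apta_acts A \<and> pta_clocks M = apta_clocks A \<and> pta_props M = apta_props A \<and>
         pta_satisfies C M A}"


subsection \<open>Abstract probabilistic event-clock automata\<close>

datatype 'a event_clock = Clk 'a

record ('l, 'a, 'p) apeca =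
  ec_locs :: "'l set"
  ec_acts :: "'a set"
  ec_props :: "'p set"
  ec_lab :: "'l \<Rightarrow> 'p set set"
  ec_trans :: "'l \<Rightarrow> 'a event_clock guard \<Rightarrow> 'a \<Rightarrow> 'l pmf set \<Rightarrow> b3"
  ec_init :: "'l"

definition ec_clocks :: "('l, 'a, 'p) apeca \<Rightarrow> 'a event_clock set" where
  "ec_clocks E = Clk ` ec_acts E"

definition is_apeca :: "real set \<Rightarrow> ('l, 'a, 'p) apeca \<Rightarrow> bool" where
  "is_apeca C E \<longleftrightarrow>
     finite (ec_acts E) \<and>
     ec_init E \<in> ec_locs E \<and>
     (\<forall>l\<in>ec_locs E. ec_lab E l \<subseteq> Pow (ec_props E)) \<and>
     (\<forall>l g a \<phi>. ec_trans E l g a \<phi> \<noteq> BBot \<longrightarrow>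
        l \<in> ec_locs E \<and> g \<in> CC C (ec_clocks E) \<and> a \<in> ec_acts E \<and> \<phi> \<subseteq> Dist (ec_locs E)) \<and>
     (\<forall>l\<in>ec_locs E. \<forall>a\<in>ec_acts E.
        (\<Union>g\<in>{g. \<exists>\<phi>. ec_trans E l g a \<phi> \<noteq> BBot}. guard_sem (ec_clocks E) g)
          = valuations (ec_clocks E))"

definition ec_hat :: "'a \<Rightarrow> 'l pmf \<Rightarrow> ('a event_clock set \<times> 'l) pmf" where
  "ec_hat a \<mu> = map_pmf (\<lambda>l'. ({Clk a}, l')) \<mu>"

text \<open>
  \<open>ec_hat a\<close> is injective, so a constraint \<open>\<psi>\<close> of the form \<open>ec_hat a ` \<phi>\<close> determines \<open>\<phi>\<close> as
  \<open>ec_hat a -` \<psi>\<close>.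
\<close>

definition apta_of :: "('l, 'a, 'p) apeca \<Rightarrow> ('l, 'a, 'a event_clock, 'p) apta" where
  "apta_of E =
     \<lparr>apta_locs = ec_locs E,
      apta_acts = ec_acts E,
      apta_clocks = ec_clocks E,
      apta_props = ec_props E,
      apta_lab = ec_lab E,
      apta_trans = (\<lambda>l g a \<psi>.
        if \<psi> \<subseteq> range (ec_hat a) then ec_trans E l g a (ec_hat a -` \<psi>) else BBot),
      apta_init = ec_init E\<rparr>"

definition ec_implementations ::
  "real set \<Rightarrow> ('l, 'a, 'p) apeca \<Rightarrow> ('m, 'a, 'a event_clock, 'p) pta set" where
  "ec_implementations C E = implementations C (apta_of E)"

definition action_deterministic :: "real set \<Rightarrow> ('l, 'a, 'p) apeca \<Rightarrow> bool" where
  "action_deterministic C E \<longleftrightarrow>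
     (\<forall>(l, \<theta>)\<in>apta_reach C (apta_of E). \<forall>a g\<^sub>1 \<phi>\<^sub>1 g\<^sub>2 \<phi>\<^sub>2.
        \<forall>\<theta>\<^sub>1\<in>regions C (ec_clocks E). \<forall>\<theta>\<^sub>2\<in>regions C (ec_clocks E).
          ec_trans E l g\<^sub>1 a \<phi>\<^sub>1 \<noteq> BBot \<and> ec_trans E l g\<^sub>2 a \<phi>\<^sub>2 \<noteq> BBot \<and> \<phi>\<^sub>1 \<noteq> \<phi>\<^sub>2 \<and>
          \<theta>\<^sub>1 \<subseteq> Succ C (ec_clocks E) \<theta> \<inter> guard_sem (ec_clocks E) g\<^sub>1 \<and>
          \<theta>\<^sub>2 \<subseteq> Succ C (ec_clocks E) \<theta> \<inter> guard_sem (ec_clocks E) g\<^sub>2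
          \<longrightarrow> \<theta>\<^sub>1 \<inter> \<theta>\<^sub>2 = {})"

definition constr_conj :: "'k pmf set \<Rightarrow> 'l pmf set \<Rightarrow> ('k \<times> 'l) pmf set" where
  "constr_conj \<phi>\<^sub>1 \<phi>\<^sub>2 = {\<mu>. map_pmf fst \<mu> \<in> \<phi>\<^sub>1 \<and> map_pmf snd \<mu> \<in> \<phi>\<^sub>2}"

text \<open>
  Distinct pairs \<open>(\<phi>\<^sub>1, \<phi>\<^sub>2)\<close> can have the same conjunction (for instance the empty one), so the value
  of the transition function is the join over all pairs of edges that give rise to it.
\<close>

definition apeca_conj ::
  "('k, 'a, 'p) apeca \<Rightarrow> ('l, 'a, 'p) apeca \<Rightarrow> ('k \<times> 'l, 'a, 'p) apeca" where
  "apeca_conj E\<^sub>1 E\<^sub>2 =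
     \<lparr>ec_locs = ec_locs E\<^sub>1 \<times> ec_locs E\<^sub>2,
      ec_acts = ec_acts E\<^sub>1,
      ec_props = ec_props E\<^sub>1,
      ec_lab = (\<lambda>(l\<^sub>1, l\<^sub>2). ec_lab E\<^sub>1 l\<^sub>1 \<inter> ec_lab E\<^sub>2 l\<^sub>2),
      ec_trans = (\<lambda>(l\<^sub>1, l\<^sub>2) g a \<phi>.
        Max (insert BBot
          {max (ec_trans E\<^sub>1 l\<^sub>1 g\<^sub>1 a \<phi>\<^sub>1) (ec_trans E\<^sub>2 l\<^sub>2 g\<^sub>2 a \<phi>\<^sub>2) | g\<^sub>1 \<phi>\<^sub>1 g\<^sub>2 \<phi>\<^sub>2.
             ec_trans E\<^sub>1 l\<^sub>1 g\<^sub>1 a \<phi>\<^sub>1 \<noteq> BBot \<and> ec_trans E\<^sub>2 l\<^sub>2 g\<^sub>2 a \<phi>\<^sub>2 \<noteq> BBot \<and>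
             g = GAnd g\<^sub>1 g\<^sub>2 \<and> \<phi> = constr_conj \<phi>\<^sub>1 \<phi>\<^sub>2})),
      ec_init = (ec_init E\<^sub>1, ec_init E\<^sub>2)\<rparr>"

end

theory Submission
  imports Defs
begin

text \<open>
  Let \<open>R\<close> witness that \<open>M\<close> satisfies \<open>E\<^sub>1 \<and> E\<^sub>2\<close>. A must-edge of \<open>E\<^sub>1\<close> only yields behaviour of \<open>M\<close>
  in those regions where the conjunction is reachable, so the projection of \<open>R\<close> is restricted to
  pairs that are reachable with a common region. Normal form makes this an invariant: each
  reachable location of \<open>M\<close> has exactly one region, and each of its guards denotes a single region.
  Since the guards of \<open>E\<^sub>2\<close> cover all valuations, every valuation enabled by a must-edge of \<open>E\<^sub>1\<close> is
  enabled by a must-edge of the conjunction; finitely many edges of \<open>M\<close> suffice for the matching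
  because there are only finitely many regions.
\<close>

section \<open>Lifting of distributions\<close>

text \<open>The mass of a bind at \<open>t\<close> is the expectation of \<open>pmf (K s) t\<close>,
  a sum for discrete \<open>\<mu>\<close>. Terms outside the support vanish, so
  \<open>\<delta>\<close> only has to agree with the kernel on the support and the index set only
  has to contain it.\<close>

lemma infsum_pmf_mult_eq_pmf_bind:
  assumes "set_pmf \<mu> \<subseteq> S" and "\<And>s. s \<in> set_pmf \<mu> \<Longrightarrow> \<delta> s = pmf (K s) t"
  shows "(\<Sum>\<^sub>\<infinity>s\<in>S. pmf \<mu> s * \<delta> s) = pmf (bind_pmf \<mu> K) t"
proof -
  \<comment> \<open>Domination by \<open>pmf \<mu>\<close>; absolute summability licenses the
    passage from \<open>infsetsum\<close> to \<open>infsum\<close>.\<close>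
  have "Infinite_Set_Sum.abs_summable_on (\<lambda>s. pmf \<mu> s * pmf (K s) t) UNIV"
    by (rule abs_summable_on_comparison_test[OF pmf_abs_summable[of \<mu>]])
      (simp add: mult_left_le pmf_le_1)
  then have "pmf (bind_pmf \<mu> K) t = (\<Sum>\<^sub>\<infinity>s. pmf \<mu> s * pmf (K s) t)"
    by (simp add: pmf_bind pmf_expectation_eq_infsetsum infsetsum_infsum)
  also have "\<dots> = (\<Sum>\<^sub>\<infinity>s\<in>S. pmf \<mu> s * \<delta> s)"
  proof (rule infsum_cong_neutral)
    show "pmf \<mu> s * pmf (K s) t = 0" if "s \<in> UNIV - S" for s
      using that assms(1) by (auto simp: set_pmf_iff)
    show "pmf \<mu> s * pmf (K s) t = pmf \<mu> s * \<delta> s" for s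
      using assms(2)[of s] by (cases "s \<in> set_pmf \<mu>") (simp_all add: set_pmf_iff)
  qed simp
  finally show ?thesis ..
qed

text \<open>A weight function \<open>\<delta>\<close> is a Markov kernel and its weighted sum is the
  monadic bind. In this form, pushing a lifting forward along a map becomes a monad law.\<close>

lemma dist_lift_iff_bind:
  assumes \<mu>: "\<mu> \<in> Dist S" and \<mu>': "\<mu>' \<in> Dist S'"
  shows "dist_lift S S' R \<mu> \<mu>' \<longleftrightarrow>
    (\<exists>K. \<mu>' = bind_pmf \<mu> K \<and> (\<forall>s\<in>set_pmf \<mu>. set_pmf (K s) \<subseteq> S' \<inter> R `` {s}))"
proof
  assume "dist_lift S S' R \<mu> \<mu>'"
  then obtain \<delta> where
    dist: "\<And>s. s \<in> S \<Longrightarrow> pmf \<mu> s > 0 \<Longrightarrow> \<exists>p\<in>Dist S'. \<forall>s'\<in>S'. \<delta> s s' = pmf p s'"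
    and sum: "\<And>s'. s' \<in> S' \<Longrightarrow> pmf \<mu>' s' = (\<Sum>\<^sub>\<infinity>s\<in>S. pmf \<mu> s * \<delta> s s')"
    and R: "\<And>s s'. s \<in> S \<Longrightarrow> s' \<in> S' \<Longrightarrow> \<delta> s s' > 0 \<Longrightarrow> (s, s') \<in> R"
    unfolding dist_lift_def by blast
  have "\<forall>s\<in>set_pmf \<mu>. \<exists>p\<in>Dist S'. \<forall>s'\<in>S'. \<delta> s s' = pmf p s'"
    using dist \<mu> by (auto simp: Dist_def pmf_positive)
  then obtain K where K: "\<And>s. s \<in> set_pmf \<mu> \<Longrightarrow> K s \<in> Dist S'"
    "\<And>s s'. s \<in> set_pmf \<mu> \<Longrightarrow> s' \<in> S' \<Longrightarrow> \<delta> s s' = pmf (K s) s'"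
    by metis
  have "pmf \<mu>' t = pmf (bind_pmf \<mu> K) t" for t
  \<comment> \<open>The sum formula only speaks about points of \<open>S'\<close>; elsewhere both
    sides have mass 0.\<close>
  proof (cases "t \<in> S'")
    case True
    then show ?thesis
      using sum K(2) \<mu> by (simp add: infsum_pmf_mult_eq_pmf_bind Dist_def)
  next
    case False
    then have "t \<notin> set_pmf \<mu>'" "t \<notin> set_pmf (bind_pmf \<mu> K)"
      using \<mu>' K(1) by (auto simp: Dist_def)
    then show ?thesis
      by (metis pmf_eq_0_set_pmf)
  qed
  then have "\<mu>' = bind_pmf \<mu> K"
    by (rule pmf_eqI)
  moreover have "set_pmf (K s) \<subseteq> S' \<inter> R `` {s}" if s: "s \<in> set_pmf \<mu>" for s
  proof
    fix s' assume s': "s' \<in> set_pmf (K s)"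
    then have "s' \<in> S'" using K(1)[OF s] by (auto simp: Dist_def)
    moreover from this have "(s, s') \<in> R"
      using R[of s s'] K(2)[OF s] s s' \<mu> by (auto simp: Dist_def pmf_positive)
    ultimately show "s' \<in> S' \<inter> R `` {s}" by simp
  qed
  ultimately show "\<exists>K. \<mu>' = bind_pmf \<mu> K \<and> (\<forall>s\<in>set_pmf \<mu>. set_pmf (K s) \<subseteq> S' \<inter> R `` {s})"
    by blast
next
  assume "\<exists>K. \<mu>' = bind_pmf \<mu> K \<and> (\<forall>s\<in>set_pmf \<mu>. set_pmf (K s) \<subseteq> S' \<inter> R `` {s})"
  then obtain K where K: "\<mu>' = bind_pmf \<mu> K"
    "\<And>s. s \<in> set_pmf \<mu> \<Longrightarrow> set_pmf (K s) \<subseteq> S' \<inter> R `` {s}"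
    by blast
  \<comment> \<open>\<open>K\<close> is unconstrained off the support of \<open>\<mu>\<close>. The
    value 0 there makes the clause about \<open>R\<close> hold on all of \<open>S\<close>.\<close>
  define \<delta> where "\<delta> s s' = (if s \<in> set_pmf \<mu> then pmf (K s) s' else 0)" for s s'
  have "0 \<le> \<delta> s s' \<and> \<delta> s s' \<le> 1" for s s'
    by (simp add: \<delta>_def pmf_le_1)
  moreover have "\<exists>p\<in>Dist S'. \<forall>s'\<in>S'. \<delta> s s' = pmf p s'" if "pmf \<mu> s > 0" for s
  proof -
    have "s \<in> set_pmf \<mu>" using that by (simp add: set_pmf_iff)
    then show ?thesis using K(2) by (intro bexI[of _ "K s"]) (auto simp: \<delta>_def Dist_def)
  qed
  moreover have "pmf \<mu>' s' = (\<Sum>\<^sub>\<infinity>s\<in>S. pmf \<mu> s * \<delta> s s')" for s'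
    using \<mu> unfolding K(1)
    by (intro infsum_pmf_mult_eq_pmf_bind[symmetric]) (auto simp: \<delta>_def Dist_def)
  moreover have "(s, s') \<in> R" if "\<delta> s s' > 0" for s s'
  proof -
    have "s \<in> set_pmf \<mu>" "s' \<in> set_pmf (K s)"
      using that by (auto simp: \<delta>_def pmf_positive_iff split: if_splits)
    then show ?thesis using K(2) by blast
  qed
  ultimately show "dist_lift S S' R \<mu> \<mu>'"
    unfolding dist_lift_def by blast
qed

text \<open>The kernel is composed with \<open>f\<close>. That \<open>Q\<close> is checked only on
  supports matters: there the targets are known to be reachable.\<close>

lemma dist_lift_map_pmf:
  assumes lift: "dist_lift S S' R \<mu> \<mu>'" and \<mu>: "\<mu> \<in> Dist S" and \<mu>': "\<mu>' \<in> Dist S'"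
    and f: "f ` S' \<subseteq> T"
    and Q: "\<And>s s'. s \<in> set_pmf \<mu> \<Longrightarrow> s' \<in> set_pmf \<mu>' \<Longrightarrow> (s, s') \<in> R \<Longrightarrow> (s, f s') \<in> Q"
  shows "dist_lift S T Q \<mu> (map_pmf f \<mu>')"
proof -
  obtain K where K: "\<mu>' = bind_pmf \<mu> K"
    "\<And>s. s \<in> set_pmf \<mu> \<Longrightarrow> set_pmf (K s) \<subseteq> S' \<inter> R `` {s}"
    using lift dist_lift_iff_bind[OF \<mu> \<mu>'] by blast
  have "map_pmf f \<mu>' \<in> Dist T"
    using \<mu>' f by (auto simp: Dist_def)
  moreover have "map_pmf f \<mu>' = bind_pmf \<mu> (\<lambda>s. map_pmf f (K s))"
    by (simp add: K(1) map_bind_pmf)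
  moreover have "set_pmf (map_pmf f (K s)) \<subseteq> T \<inter> Q `` {s}" if "s \<in> set_pmf \<mu>" for s
    using K(2)[OF that] f Q[OF that] that by (auto simp: K(1))
  ultimately show ?thesis
    using dist_lift_iff_bind[OF \<mu>] by blast
qed

section \<open>Regions\<close>

lemma mem_region_of: "v \<in> valuations X \<Longrightarrow> v \<in> region_of C X v"
  by (simp add: region_of_def)

lemma region_eqI:
  assumes "\<theta> \<in> regions C X" "\<theta>' \<in> regions C X" "v \<in> \<theta>" "v \<in> \<theta>'"
  shows "\<theta> = \<theta>'"
  using assms by (auto simp: regions_def region_of_def)

lemma region_nonempty: "\<theta> \<in> regions C X \<Longrightarrow> \<theta> \<noteq> {}"
  using mem_region_of by (fastforce simp: regions_def)

lemma region_subset_eq: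
  assumes "\<theta> \<in> regions C X" "\<theta>' \<in> regions C X" "\<theta> \<subseteq> \<theta>'"
  shows "\<theta> = \<theta>'"
  using region_nonempty[OF assms(1)] region_eqI[OF assms(1,2)] assms(3) by blast

text \<open>Regions are the classes of guard equivalence, so a guard in \<open>CC C X\<close> cannot
  split one. This turns a single shared valuation into an inclusion.\<close>

lemma region_subset_guard:
  assumes "\<theta> \<in> regions C X" "g \<in> CC C X" "v \<in> \<theta>" "v \<in> guard_sem X g"
  shows "\<theta> \<subseteq> guard_sem X g"
  using assms by (auto simp: regions_def region_of_def guard_sem_def)

lemma finite_cmp_UNIV: "finite (UNIV :: cmp set)"
proof -
  have "(UNIV :: cmp set) = {Lt, Le, Eq, Ge, Gt}"
    using cmp.exhaust by auto
  then show ?thesis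
    by (metis finite.emptyI finite.insertI)
qed

text \<open>The atoms true at a valuation determine its region, since conjunctions add no
  information, and there are finitely many atoms over \<open>X\<close> and \<open>C\<close>.\<close>

lemma finite_regions:
  assumes "finite C" "finite X"
  shows "finite (regions C X)"
proof -
  define atoms where
    "atoms v = {(x, r, c). x \<in> X \<and> c \<in> C \<and> cmp_sem r (v x) c}" for v :: "'a \<Rightarrow> real"
  have sat: "guard_sat v g \<longleftrightarrow> guard_sat w g" if "g \<in> CC C X" "atoms v = atoms w" for g v w
    using that
  proof (induction g)
    case (GAtom x r c)
    then have "(x, r, c) \<in> atoms v \<longleftrightarrow> (x, r, c) \<in> atoms w" by simp
    then show ?case using GAtom(1) by (simp add: atoms_def CC_def)
  qed (auto simp: CC_def)
  have "region_of C X v = region_of C X w" if "atoms v = atoms w" for v w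
    using sat[OF _ that] by (simp add: region_of_def)
  \<comment> \<open>Choosing one representative valuation per set of true atoms exhibits the regions
    as images of finitely many sets.\<close>
  then have "region_of C X v = region_of C X (inv_into (valuations X) atoms (atoms v))"
    if "v \<in> valuations X" for v
    using that by (metis f_inv_into_f imageI)
  then have "regions C X \<subseteq> (\<lambda>P. region_of C X (inv_into (valuations X) atoms P)) ` range atoms"
    by (auto simp: regions_def)
  moreover have "range atoms \<subseteq> Pow (X \<times> UNIV \<times> C)"
    by (auto simp: atoms_def)
  then have "finite (range atoms)"
    using assms finite_cmp_UNIV by (meson finite_Pow_iff finite_SigmaI finite_subset)
  ultimately show ?thesis
    by (meson finite_imageI finite_subset)
qed

section \<open>Normal form\<close>

text \<open>\<open>reg l\<close> is the region component of the image of \<open>l\<close> under the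
  isomorphism with the region PTA. Isomorphism carries over the shape of edges there: each guard is
  one region, and each target stores the reset of that region.\<close>

lemma normal_form_region:
  fixes M :: "('l, 'a, 'c, 'p) pta"
  assumes pta: "is_pta C M" and nf: "normal_form C M"
  obtains reg where "\<And>l \<theta>. (l, \<theta>) \<in> pta_reach C M \<Longrightarrow> \<theta> = reg l"
    and "\<And>l g a \<mu>. pta_trans M l g a \<mu> \<Longrightarrow>
      guard_sem (pta_clocks M) g \<in> regions C (pta_clocks M) \<and>
      guard_sem (pta_clocks M) g \<subseteq> Succ C (pta_clocks M) (reg l)"
proof -
  let ?X = "pta_clocks M" and ?N = "region_pta C M"
  obtain f where init: "f (pta_init M) = pta_init ?N"
    and iso: "\<forall>l\<in>pta_locs M. \<forall>a\<in>pta_acts M. \<forall>\<mu>\<in>Dist (Pow ?X \<times> pta_locs M). \<forall>Z.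
       (\<exists>g. pta_trans M l g a \<mu> \<and> guard_sem ?X g = Z) \<longleftrightarrow>
       (\<exists>h. pta_trans ?N (f l) h a (map_pmf (map_prod id f) \<mu>) \<and>
            guard_sem (pta_clocks ?N) h = Z)"
    using nf unfolding normal_form_def pta_iso_def by (elim conjE exE) (rule that)
  have edge: "guard_sem ?X g \<in> regions C ?X \<and> guard_sem ?X g \<subseteq> Succ C ?X (snd (f l)) \<and>
      (\<forall>(Y, l')\<in>set_pmf \<mu>. snd (f l') = reset ?X Y ` guard_sem ?X g)"
    if e: "pta_trans M l g a \<mu>" for l g a \<mu>
  proof -
    have "l \<in> pta_locs M" "a \<in> pta_acts M" "\<mu> \<in> Dist (Pow ?X \<times> pta_locs M)"
      using pta e by (auto simp: is_pta_def)
    from iso[rule_format, OF this, of "guard_sem ?X g"] e obtain h where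
      h: "pta_trans ?N (f l) h a (map_pmf (map_prod id f) \<mu>)" "guard_sem ?X h = guard_sem ?X g"
      by (auto simp: region_pta_def)
    obtain k \<theta> where fl: "f l = (k, \<theta>)" by fastforce
    from h fl obtain \<mu>' where "guard_sem ?X g \<in> regions C ?X"
      "guard_sem ?X g \<subseteq> Succ C ?X \<theta>"
      and eq: "map_pmf (map_prod id f) \<mu> =
        map_pmf (\<lambda>(Y, l'). (Y, (l', reset ?X Y ` guard_sem ?X g))) \<mu>'"
      by (auto simp: region_pta_def)
    moreover have "snd (f l') = reset ?X Y ` guard_sem ?X g" if "(Y, l') \<in> set_pmf \<mu>" for Y l'
    proof -
      \<comment> \<open>Both sides of \<open>eq\<close> have the same support, and on the right
        every outcome with reset \<open>Y\<close> carries the region reset by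
        \<open>Y\<close>.\<close>
      have "map_prod id f (Y, l') \<in> set_pmf (map_pmf (map_prod id f) \<mu>)"
        using that by (simp only: set_map_pmf imageI)
      then show ?thesis unfolding eq by auto
    qed
    ultimately show ?thesis using fl by auto
  qed
  have "\<theta> = snd (f l)" if "(l, \<theta>) \<in> pta_reach C M" for l \<theta>
    using that unfolding pta_reach_def
  proof (induction rule: region_reach.induct)
    case init
    show ?case by (simp add: \<open>f (pta_init M) = pta_init ?N\<close>) (simp add: region_pta_def)
  next
    case (step l \<theta> g a \<mu> \<theta>'' Y l')
    \<comment> \<open>The guard is itself a region, so the only region inside it is the
      guard.\<close>
    have "\<theta>'' = guard_sem ?X g"
      using region_subset_eq[of \<theta>''] edge[OF step(2)] step by blast
    then show ?case using edge[OF step(2)] step by auto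
  qed
  then show thesis
    using edge by (intro that[of "\<lambda>l. snd (f l)"]) simp_all
qed

section \<open>Projections of specifications\<close>

text \<open>Both halves of the theorem come from this, with \<open>\<pi>\<close> being
  \<open>fst\<close> or \<open>snd\<close>. Condition \<open>must\<close> is pointwise: valuations
  in the guard of one must-edge of \<open>B\<close> may be served by different must-edges of
  \<open>A\<close>.\<close>

lemma implementations_projection:
  fixes A :: "('k, 'a, 'c, 'p) apta" and B :: "('l, 'a, 'c, 'p) apta"
    and M :: "('m, 'a, 'c, 'p) pta"
  assumes fin: "finite C"
    and sig: "apta_acts A = apta_acts B" "apta_clocks A = apta_clocks B"
      "apta_props A = apta_props B"
    and wf: "\<And>l g a \<phi>. apta_trans A l g a \<phi> \<noteq> BBot \<Longrightarrow>
      g \<in> CC C (apta_clocks A) \<and> \<phi> \<subseteq> Dist (Pow (apta_clocks A) \<times> apta_locs A)"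
    and locs: "\<pi> ` apta_locs A \<subseteq> apta_locs B" and init: "\<pi> (apta_init A) = apta_init B"
    and lab: "\<And>l. l \<in> apta_locs A \<Longrightarrow> apta_lab A l \<subseteq> apta_lab B (\<pi> l)"
    and may: "\<And>l g a \<phi>. apta_trans A l g a \<phi> \<noteq> BBot \<Longrightarrow>
      \<exists>g' \<phi>'. apta_trans B (\<pi> l) g' a \<phi>' \<noteq> BBot \<and>
        guard_sem (apta_clocks A) g \<subseteq> guard_sem (apta_clocks A) g' \<and>
        map_pmf (map_prod id \<pi>) ` \<phi> \<subseteq> \<phi>'"
    and must: "\<And>l g' a \<phi>' v. l \<in> apta_locs A \<Longrightarrow> apta_trans B (\<pi> l) g' a \<phi>' = BTop \<Longrightarrow>
      v \<in> guard_sem (apta_clocks A) g' \<Longrightarrow>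
      \<exists>g \<phi>. apta_trans A l g a \<phi> = BTop \<and> v \<in> guard_sem (apta_clocks A) g \<and>
        map_pmf (map_prod id \<pi>) ` \<phi> \<subseteq> \<phi>'"
    and M: "M \<in> implementations C A"
  shows "M \<in> implementations C B"
proof -
  define X where "X = pta_clocks M"
  from M have pta: "is_pta C M" and nf: "normal_form C M"
    and X: "apta_clocks A = X" "pta_clocks M = X" "apta_clocks B = X"
    using sig by (auto simp: implementations_def X_def)
  from M obtain R where R0: "(pta_init M, apta_init A) \<in> R" and sat: "sat_relation C M A R"
    by (auto simp: implementations_def pta_satisfies_def)
  have Rsub: "R \<subseteq> pta_locs M \<times> apta_locs A"
    using sat by (simp add: sat_relation_def)
  note sat_at = bspec[OF conjunct2[OF sat[unfolded sat_relation_def]], unfolded X prod.case]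
  have finX: "finite X"
    using pta X by (simp add: is_pta_def)
  obtain reg where reg: "\<And>m \<theta>. (m, \<theta>) \<in> pta_reach C M \<Longrightarrow> \<theta> = reg m"
    and nf_edge: "\<And>m h a \<mu>. pta_trans M m h a \<mu> \<Longrightarrow>
      guard_sem X h \<in> regions C X \<and> guard_sem X h \<subseteq> Succ C X (reg m)"
    using normal_form_region[OF pta nf] X by metis
  define Rr where
    "Rr = {(m, l) \<in> R. \<exists>\<theta>. (m, \<theta>) \<in> pta_reach C M \<and> (l, \<theta>) \<in> apta_reach C A}"
  define Q where "Q = {(m, \<pi> l) | m l. (m, l) \<in> Rr}"
  \<comment> \<open>Related targets stay in \<open>Rr\<close>: by \<open>hg\<close>, both automata
    can fire in the region denoted by \<open>h\<close>, and resetting the same \<open>Y\<close>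
    leads both to the same region.\<close>
  have lift: "edge_lift M B Q \<mu> (map_pmf (map_prod id \<pi>) \<mu>')"
    if ml: "(m, l) \<in> Rr" and e: "pta_trans M m h a \<mu>" and e': "apta_trans A l g a \<phi> \<noteq> BBot"
      and hg: "guard_sem X h \<subseteq> guard_sem X g" and \<mu>': "\<mu>' \<in> \<phi>" and l: "edge_lift M A R \<mu> \<mu>'"
    for m l h a \<mu> g \<phi> \<mu>'
    unfolding edge_lift_def
  proof (rule dist_lift_map_pmf[OF l[unfolded edge_lift_def]])
    show "\<mu> \<in> Dist (Pow (pta_clocks M) \<times> pta_locs M)"
      using pta e by (auto simp: is_pta_def)
    show "\<mu>' \<in> Dist (Pow (apta_clocks A) \<times> apta_locs A)"
      using wf[OF e'] \<mu>' by blast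
    show "map_prod id \<pi> ` (Pow (apta_clocks A) \<times> apta_locs A)
        \<subseteq> Pow (apta_clocks B) \<times> apta_locs B"
      using locs X by auto
    fix s s'
    assume s: "s \<in> set_pmf \<mu>" "s' \<in> set_pmf \<mu>'"
      and R: "(s, s') \<in> {((Y, l), (Y', l')). Y = Y' \<and> (l, l') \<in> R}"
    then obtain Y m' l' where s_eq: "s = (Y, m')" "s' = (Y, l')" and R': "(m', l') \<in> R"
      by auto
    have r: "(m, reg m) \<in> pta_reach C M" "(l, reg m) \<in> apta_reach C A"
      using ml reg by (auto simp: Rr_def)
    have "(m', reset X Y ` guard_sem X h) \<in> pta_reach C M"
      using region_reach.step[OF r(1)[unfolded pta_reach_def X] e, of "guard_sem X h" Y m']
        nf_edge[OF e] s by (simp add: pta_reach_def X s_eq)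
    moreover have "(l', reset X Y ` guard_sem X h) \<in> apta_reach C A"
      using region_reach.step[OF r(2)[unfolded apta_reach_def X], of g a \<mu>' "guard_sem X h" Y l']
        nf_edge[OF e] e' hg \<mu>' s by (auto simp: apta_reach_def X s_eq)
    ultimately show "(s, map_prod id \<pi> s') \<in> {((Y, l), (Y', l')). Y = Y' \<and> (l, l') \<in> Q}"
      using R' by (auto simp: Q_def Rr_def s_eq)
  qed
  have must': "\<exists>I. finite I \<and>
      (\<forall>(h, \<mu>)\<in>I. pta_trans M m h a \<mu> \<and> (\<exists>\<mu>'\<in>\<phi>'. edge_lift M B Q \<mu> \<mu>')) \<and>
      Succ C X \<theta> \<inter> guard_sem X g' \<subseteq> Succ C X \<theta> \<inter> (\<Union>(h, \<mu>)\<in>I. guard_sem X h)"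
    if ml: "(m, l) \<in> Rr" and e': "apta_trans B (\<pi> l) g' a \<phi>' = BTop"
      and \<theta>: "(m, \<theta>) \<in> pta_reach C M" for m l g' a \<phi>' \<theta>
  proof -
    \<comment> \<open>All usable edges of \<open>M\<close>. This set may be infinite, as one region
      is denoted by many syntactic guards; a finite choice is made below.\<close>
    define edges where
      "edges = {(h, \<mu>). pta_trans M m h a \<mu> \<and> (\<exists>\<mu>'\<in>\<phi>'. edge_lift M B Q \<mu> \<mu>')}"
    have cover: "\<exists>(h, \<mu>)\<in>edges. v \<in> guard_sem X h"
      if v: "v \<in> Succ C X \<theta>" "v \<in> guard_sem X g'" for v
    proof -
      \<comment> \<open>Reachability of \<open>l\<close> comes from \<open>Rr\<close>: its common
        region is \<open>reg m\<close>, which equals \<open>\<theta>\<close>.\<close>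
      have ml': "(m, l) \<in> R" "l \<in> apta_locs A" "(l, \<theta>) \<in> apta_reach C A"
        using ml Rsub reg[OF \<theta>] reg by (auto simp: Rr_def)
      obtain g \<phi> where g: "apta_trans A l g a \<phi> = BTop" "v \<in> guard_sem X g"
        "map_pmf (map_prod id \<pi>) ` \<phi> \<subseteq> \<phi>'"
        using must[OF ml'(2) e', of v] v(2) unfolding X by blast
      have "\<exists>I. finite I \<and>
          (\<forall>(h, \<mu>)\<in>I. pta_trans M m h a \<mu> \<and> (\<exists>\<mu>'\<in>\<phi>. edge_lift M A R \<mu> \<mu>')) \<and>
          Succ C X \<theta> \<inter> guard_sem X g \<subseteq> Succ C X \<theta> \<inter> (\<Union>(h, \<mu>)\<in>I. guard_sem X h)"
        using sat_at[OF ml'(1)] \<theta> ml'(3) g(1) by blast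
      then obtain h \<mu> \<mu>' where h: "pta_trans M m h a \<mu>" "\<mu>' \<in> \<phi>" "edge_lift M A R \<mu> \<mu>'"
        "v \<in> guard_sem X h"
        using v(1) g(2) by blast
      \<comment> \<open>The must-clause only yields an \<open>h\<close> containing \<open>v\<close>.
        As \<open>h\<close> denotes one region, sharing \<open>v\<close> with \<open>g\<close> puts
        it entirely inside \<open>g\<close>.\<close>
      have "guard_sem X h \<subseteq> guard_sem X g"
      proof (rule region_subset_guard)
        show "guard_sem X h \<in> regions C X" using nf_edge[OF h(1)] ..
        show "g \<in> CC C X" using wf[of l g a \<phi>] g(1) X by simp
      qed (fact h(4) g(2))+
      then have "edge_lift M B Q \<mu> (map_pmf (map_prod id \<pi>) \<mu>')"
        using lift[OF ml h(1) _ _ h(2,3), of g] g(1) by simp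
      then have "(h, \<mu>) \<in> edges"
        using h(1,2) g(3) by (auto simp: edges_def)
      then show ?thesis using h(4) by blast
    qed
    \<comment> \<open>One edge per guard region suffices for the cover, and there are finitely many
      regions.\<close>
    define Zs where "Zs = {guard_sem X h | h \<mu>. (h, \<mu>) \<in> edges}"
    have "Zs \<subseteq> regions C X"
      using nf_edge by (auto simp: Zs_def edges_def)
    then have "finite Zs"
      using finite_regions[OF fin finX] finite_subset by blast
    moreover have "\<forall>Z\<in>Zs. \<exists>e\<in>edges. guard_sem X (fst e) = Z"
      by (force simp: Zs_def)
    then obtain pick where pick: "\<And>Z. Z \<in> Zs \<Longrightarrow> pick Z \<in> edges"
      "\<And>Z. Z \<in> Zs \<Longrightarrow> guard_sem X (fst (pick Z)) = Z"
      by metis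
    have "v \<in> (\<Union>(h, \<mu>)\<in>pick ` Zs. guard_sem X h)"
      if v: "v \<in> Succ C X \<theta> \<inter> guard_sem X g'" for v
    proof -
      obtain h \<mu> where "(h, \<mu>) \<in> edges" "v \<in> guard_sem X h"
        using cover v by blast
      then obtain Z where Z: "Z \<in> Zs" "v \<in> Z"
        by (auto simp: Zs_def)
      then show ?thesis using pick(2)[OF Z(1)] by (auto simp: case_prod_beta)
    qed
    ultimately show ?thesis
      using pick(1) by (intro exI[of _ "pick ` Zs"]) (auto simp: edges_def)
  qed
  have "sat_relation C M B Q"
    unfolding sat_relation_def X
  proof (intro conjI ballI, goal_cases)
    case 1
    then show ?case using Rsub locs by (auto simp: Q_def Rr_def)
  next
    case (2 q)
    then obtain m l where q: "q = (m, \<pi> l)" and ml: "(m, l) \<in> Rr" by (auto simp: Q_def)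
    have ml': "(m, l) \<in> R" "l \<in> apta_locs A" using ml Rsub by (auto simp: Rr_def)
    have "\<exists>g' \<phi>'. apta_trans B (\<pi> l) g' a \<phi>' \<noteq> BBot \<and> guard_sem X h \<subseteq> guard_sem X g' \<and>
        (\<exists>\<mu>'\<in>\<phi>'. edge_lift M B Q \<mu> \<mu>')" if e: "pta_trans M m h a \<mu>" for h a \<mu>
    proof -
      have "\<exists>g \<phi>. apta_trans A l g a \<phi> \<noteq> BBot \<and> guard_sem X h \<subseteq> guard_sem X g \<and>
          (\<exists>\<mu>'\<in>\<phi>. edge_lift M A R \<mu> \<mu>')"
        using sat_at[OF ml'(1)] e by blast
      then obtain g \<phi> \<mu>' where g: "apta_trans A l g a \<phi> \<noteq> BBot"
        "guard_sem X h \<subseteq> guard_sem X g" "\<mu>' \<in> \<phi>" "edge_lift M A R \<mu> \<mu>'"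
        by blast
      then show ?thesis
        using lift[OF ml e g] may[OF g(1)] X by blast
    qed
    moreover have "pta_lab M m \<in> apta_lab B (\<pi> l)"
      using sat_at[OF ml'(1)] lab ml'(2) by blast
    ultimately show ?case using must'[OF ml] by (simp add: q)
  qed
  moreover have "(pta_init M, apta_init B) \<in> Q"
  proof -
    have "(pta_init M, region_of C X (zero_val X)) \<in> pta_reach C M"
      "(apta_init A, region_of C X (zero_val X)) \<in> apta_reach C A"
      by (simp_all add: pta_reach_def apta_reach_def X region_reach.init)
    then show ?thesis using R0 init by (force simp: Q_def Rr_def)
  qed
  ultimately show ?thesis
    using M sig by (auto simp: implementations_def pta_satisfies_def)
qed

section \<open>Transfer to event-clock automata\<close>

lemma inj_ec_hat: "inj (ec_hat a)"
  unfolding ec_hat_def by (intro pmf.inj_map injI) simp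

lemma apta_of_trans: "apta_trans (apta_of E) l g a (ec_hat a ` \<phi>) = ec_trans E l g a \<phi>"
  by (auto simp: apta_of_def inj_vimage_image_eq[OF inj_ec_hat])

lemma apta_of_transE:
  assumes "apta_trans (apta_of E) l g a \<psi> \<noteq> BBot"
  obtains \<phi> where "\<psi> = ec_hat a ` \<phi>" "ec_trans E l g a \<phi> \<noteq> BBot"
  using assms by (auto simp: apta_of_def image_vimage_eq Int_absorb2 split: if_splits
      intro: that[of "ec_hat a -` \<psi>"])

lemma map_pmf_ec_hat: "map_pmf (map_prod id f) (ec_hat a \<mu>) = ec_hat a (map_pmf f \<mu>)"
  by (simp add: ec_hat_def pmf.map_comp comp_def)

text \<open>All outcomes of an \<open>a\<close>-edge carry the same reset \<open>{Clk a}\<close>, so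
  a map on locations commutes with \<open>ec_hat a\<close>, and the conditions can be stated on
  constraints over locations alone.\<close>

lemma ec_implementations_projection:
  fixes D :: "('k, 'a, 'p) apeca" and E :: "('l, 'a, 'p) apeca"
  assumes fin: "finite C"
    and sig: "ec_acts D = ec_acts E" "ec_props D = ec_props E"
    and wf: "\<And>l g a \<phi>. ec_trans D l g a \<phi> \<noteq> BBot \<Longrightarrow>
      g \<in> CC C (ec_clocks D) \<and> a \<in> ec_acts D \<and> \<phi> \<subseteq> Dist (ec_locs D)"
    and locs: "\<pi> ` ec_locs D \<subseteq> ec_locs E" and init: "\<pi> (ec_init D) = ec_init E"
    and lab: "\<And>l. l \<in> ec_locs D \<Longrightarrow> ec_lab D l \<subseteq> ec_lab E (\<pi> l)"
    and may: "\<And>l g a \<phi>. ec_trans D l g a \<phi> \<noteq> BBot \<Longrightarrow>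
      \<exists>g' \<phi>'. ec_trans E (\<pi> l) g' a \<phi>' \<noteq> BBot \<and>
        guard_sem (ec_clocks D) g \<subseteq> guard_sem (ec_clocks D) g' \<and> map_pmf \<pi> ` \<phi> \<subseteq> \<phi>'"
    and must: "\<And>l g' a \<phi>' v. l \<in> ec_locs D \<Longrightarrow> ec_trans E (\<pi> l) g' a \<phi>' = BTop \<Longrightarrow>
      v \<in> guard_sem (ec_clocks D) g' \<Longrightarrow>
      \<exists>g \<phi>. ec_trans D l g a \<phi> = BTop \<and> v \<in> guard_sem (ec_clocks D) g \<and> map_pmf \<pi> ` \<phi> \<subseteq> \<phi>'"
  shows "ec_implementations C D \<subseteq> ec_implementations C E"
proof
  fix M :: "('m, 'a, 'a event_clock, 'p) pta"
  have sel: "apta_locs (apta_of F) = ec_locs F" "apta_acts (apta_of F) = ec_acts F"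
    "apta_clocks (apta_of F) = ec_clocks F" "apta_props (apta_of F) = ec_props F"
    "apta_lab (apta_of F) = ec_lab F" "apta_init (apta_of F) = ec_init F"
    for F :: "('x, 'a, 'p) apeca"
    by (simp_all add: apta_of_def)
  have map_hat: "map_pmf (map_prod id \<pi>) ` ec_hat a ` \<phi> \<subseteq> ec_hat a ` \<phi>'"
    if "map_pmf \<pi> ` \<phi> \<subseteq> \<phi>'" for a \<phi> \<phi>'
    using that by (auto simp: map_pmf_ec_hat)
  assume M: "M \<in> ec_implementations C D"
  have clocks: "ec_clocks D = ec_clocks E"
    by (simp add: ec_clocks_def sig)
  show "M \<in> ec_implementations C E"
    unfolding ec_implementations_def
  proof (rule implementations_projection[where A = "apta_of D" and \<pi> = \<pi>, OF fin], unfold sel)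
    show "ec_acts D = ec_acts E" "ec_clocks D = ec_clocks E" "ec_props D = ec_props E"
      "\<pi> ` ec_locs D \<subseteq> ec_locs E" "\<pi> (ec_init D) = ec_init E"
      by (fact sig clocks locs init)+
    show "M \<in> implementations C (apta_of D)"
      using M by (simp add: ec_implementations_def)
    show "ec_lab D l \<subseteq> ec_lab E (\<pi> l)" if "l \<in> ec_locs D" for l
      using lab that .
  next
    fix l g a \<psi>
    assume "apta_trans (apta_of D) l g a \<psi> \<noteq> BBot"
    then obtain \<phi> where \<phi>: "\<psi> = ec_hat a ` \<phi>" "ec_trans D l g a \<phi> \<noteq> BBot"
      by (rule apta_of_transE)
    show "g \<in> CC C (ec_clocks D) \<and> \<psi> \<subseteq> Dist (Pow (ec_clocks D) \<times> ec_locs D)"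
      \<comment> \<open>Here \<open>a\<close> being an action of \<open>D\<close> makes
        \<open>{Clk a}\<close> a set of its clocks.\<close>
      using wf[OF \<phi>(2)] by (fastforce simp: \<phi>(1) Dist_def ec_hat_def ec_clocks_def)
    show "\<exists>g' \<psi>'. apta_trans (apta_of E) (\<pi> l) g' a \<psi>' \<noteq> BBot \<and>
        guard_sem (ec_clocks D) g \<subseteq> guard_sem (ec_clocks D) g' \<and>
        map_pmf (map_prod id \<pi>) ` \<psi> \<subseteq> \<psi>'"
      using may[OF \<phi>(2)] map_hat unfolding \<phi>(1) by (metis apta_of_trans)
  next
    fix l g' a \<psi>' v
    assume l: "l \<in> ec_locs D" and e: "apta_trans (apta_of E) (\<pi> l) g' a \<psi>' = BTop"
      and v: "v \<in> guard_sem (ec_clocks D) g'"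
    from e obtain \<phi>' where \<phi>': "\<psi>' = ec_hat a ` \<phi>'"
      by (metis apta_of_transE b3.distinct(3))
    with e have "ec_trans E (\<pi> l) g' a \<phi>' = BTop"
      by (simp add: apta_of_trans)
    from must[OF l this v] show "\<exists>g \<psi>. apta_trans (apta_of D) l g a \<psi> = BTop \<and>
        v \<in> guard_sem (ec_clocks D) g \<and> map_pmf (map_prod id \<pi>) ` \<psi> \<subseteq> \<psi>'"
      using map_hat unfolding \<phi>' by (metis apta_of_trans)
  qed
qed

section \<open>Conjunction\<close>

lemma apeca_conj_transE:
  assumes "ec_trans (apeca_conj E\<^sub>1 E\<^sub>2) l g a \<phi> \<noteq> BBot"
  obtains g\<^sub>1 \<phi>\<^sub>1 g\<^sub>2 \<phi>\<^sub>2 where "ec_trans E\<^sub>1 (fst l) g\<^sub>1 a \<phi>\<^sub>1 \<noteq> BBot"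
    "ec_trans E\<^sub>2 (snd l) g\<^sub>2 a \<phi>\<^sub>2 \<noteq> BBot" "g = GAnd g\<^sub>1 g\<^sub>2" "\<phi> = constr_conj \<phi>\<^sub>1 \<phi>\<^sub>2"
proof -
  obtain l\<^sub>1 l\<^sub>2 where l: "l = (l\<^sub>1, l\<^sub>2)" by fastforce
  define S where "S = {max (ec_trans E\<^sub>1 l\<^sub>1 g\<^sub>1 a \<phi>\<^sub>1) (ec_trans E\<^sub>2 l\<^sub>2 g\<^sub>2 a \<phi>\<^sub>2) | g\<^sub>1 \<phi>\<^sub>1 g\<^sub>2 \<phi>\<^sub>2.
     ec_trans E\<^sub>1 l\<^sub>1 g\<^sub>1 a \<phi>\<^sub>1 \<noteq> BBot \<and> ec_trans E\<^sub>2 l\<^sub>2 g\<^sub>2 a \<phi>\<^sub>2 \<noteq> BBot \<and>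
     g = GAnd g\<^sub>1 g\<^sub>2 \<and> \<phi> = constr_conj \<phi>\<^sub>1 \<phi>\<^sub>2}"
  have "ec_trans (apeca_conj E\<^sub>1 E\<^sub>2) l g a \<phi> = Max (insert BBot S)"
    by (simp add: apeca_conj_def l S_def)
  \<comment> \<open>Over an empty \<open>S\<close> the join would be \<open>BBot\<close>.\<close>
  then have "S \<noteq> {}" using assms by auto
  then show thesis using that by (auto simp: S_def l)
qed

text \<open>Several pairs of edges can yield the same conjoined edge, so one pair only bounds the
  join from below; for \<open>BTop\<close>, the greatest element, that is enough.\<close>

lemma apeca_conj_trans_top:
  assumes "ec_trans E\<^sub>1 l\<^sub>1 g\<^sub>1 a \<phi>\<^sub>1 \<noteq> BBot" "ec_trans E\<^sub>2 l\<^sub>2 g\<^sub>2 a \<phi>\<^sub>2 \<noteq> BBot"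
    and "ec_trans E\<^sub>1 l\<^sub>1 g\<^sub>1 a \<phi>\<^sub>1 = BTop \<or> ec_trans E\<^sub>2 l\<^sub>2 g\<^sub>2 a \<phi>\<^sub>2 = BTop"
  shows "ec_trans (apeca_conj E\<^sub>1 E\<^sub>2) (l\<^sub>1, l\<^sub>2) (GAnd g\<^sub>1 g\<^sub>2) a (constr_conj \<phi>\<^sub>1 \<phi>\<^sub>2) = BTop"
proof -
  let ?S = "{max (ec_trans E\<^sub>1 l\<^sub>1 h\<^sub>1 a \<psi>\<^sub>1) (ec_trans E\<^sub>2 l\<^sub>2 h\<^sub>2 a \<psi>\<^sub>2) | h\<^sub>1 \<psi>\<^sub>1 h\<^sub>2 \<psi>\<^sub>2.
     ec_trans E\<^sub>1 l\<^sub>1 h\<^sub>1 a \<psi>\<^sub>1 \<noteq> BBot \<and> ec_trans E\<^sub>2 l\<^sub>2 h\<^sub>2 a \<psi>\<^sub>2 \<noteq> BBot \<and>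
     GAnd g\<^sub>1 g\<^sub>2 = GAnd h\<^sub>1 h\<^sub>2 \<and> constr_conj \<phi>\<^sub>1 \<phi>\<^sub>2 = constr_conj \<psi>\<^sub>1 \<psi>\<^sub>2}"
  have top: "x \<le> BTop" for x by (cases x) (simp_all add: less_eq_b3_def)
  have "max (ec_trans E\<^sub>1 l\<^sub>1 g\<^sub>1 a \<phi>\<^sub>1) (ec_trans E\<^sub>2 l\<^sub>2 g\<^sub>2 a \<phi>\<^sub>2) = BTop"
    using assms(3) top by (auto simp: max_def intro: antisym)
  then have "BTop \<in> ?S"
    using assms(1,2) by (intro CollectI exI[of _ g\<^sub>1] exI[of _ \<phi>\<^sub>1] exI[of _ g\<^sub>2] exI[of _ \<phi>\<^sub>2]) simp
  then have "BTop \<le> Max (insert BBot ?S)"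
    by (intro Max_ge) simp_all
  also have "\<dots> = ec_trans (apeca_conj E\<^sub>1 E\<^sub>2) (l\<^sub>1, l\<^sub>2) (GAnd g\<^sub>1 g\<^sub>2) a (constr_conj \<phi>\<^sub>1 \<phi>\<^sub>2)"
    by (simp only: apeca_conj_def apeca.simps prod.case)
  finally show ?thesis by (rule antisym[OF top])
qed

lemma apeca_trans_cover:
  assumes "is_apeca C E" "l \<in> ec_locs E" "a \<in> ec_acts E" "v \<in> valuations (ec_clocks E)"
  obtains g \<phi> where "ec_trans E l g a \<phi> \<noteq> BBot" "v \<in> guard_sem (ec_clocks E) g"
proof -
  have "v \<in> (\<Union>g\<in>{g. \<exists>\<phi>. ec_trans E l g a \<phi> \<noteq> BBot}. guard_sem (ec_clocks E) g)"
    using assms by (simp add: is_apeca_def)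
  then show thesis using that by blast
qed

lemma guard_sem_GAnd: "guard_sem X (GAnd g h) = guard_sem X g \<inter> guard_sem X h"
  by (auto simp: guard_sem_def)

theorem theorem6:
  fixes C :: "real set"
    and E\<^sub>1 :: "('k, 'a, 'p) apeca"
    and E\<^sub>2 :: "('l, 'a, 'p) apeca"
  assumes "finite C" and "0 \<in> C" and "C \<subseteq> {0..}"
    and "is_apeca C E\<^sub>1" and "is_apeca C E\<^sub>2"
    and "ec_acts E\<^sub>1 = ec_acts E\<^sub>2" and "ec_props E\<^sub>1 = ec_props E\<^sub>2"
    and "action_deterministic C E\<^sub>1" and "action_deterministic C E\<^sub>2"
  shows "(ec_implementations C (apeca_conj E\<^sub>1 E\<^sub>2) :: ('m, 'a, 'a event_clock, 'p) pta set)
           \<subseteq> ec_implementations C E\<^sub>1 \<inter> ec_implementations C E\<^sub>2"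
proof -
  let ?D = "apeca_conj E\<^sub>1 E\<^sub>2"
  have sel: "ec_acts ?D = ec_acts E\<^sub>1" "ec_props ?D = ec_props E\<^sub>1"
    "ec_locs ?D = ec_locs E\<^sub>1 \<times> ec_locs E\<^sub>2" "ec_init ?D = (ec_init E\<^sub>1, ec_init E\<^sub>2)"
    "\<And>l. ec_lab ?D l = ec_lab E\<^sub>1 (fst l) \<inter> ec_lab E\<^sub>2 (snd l)"
    by (auto simp: apeca_conj_def split: prod.split)
  have clocks: "ec_clocks ?D = ec_clocks E\<^sub>1" "ec_clocks E\<^sub>2 = ec_clocks E\<^sub>1"
    using assms by (simp_all add: ec_clocks_def sel)
  have edge: "ec_trans E l g a \<phi> \<noteq> BBot \<Longrightarrow>
      g \<in> CC C (ec_clocks E) \<and> a \<in> ec_acts E \<and> \<phi> \<subseteq> Dist (ec_locs E)"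
    if "is_apeca C E" for E :: "('x, 'a, 'p) apeca" and l g a \<phi>
    using that by (simp add: is_apeca_def)
  note edge\<^sub>1 = edge[OF assms(4)] and edge\<^sub>2 = edge[OF assms(5)]
  have wf: "g \<in> CC C (ec_clocks ?D) \<and> a \<in> ec_acts ?D \<and> \<phi> \<subseteq> Dist (ec_locs ?D)"
    if "ec_trans ?D l g a \<phi> \<noteq> BBot" for l g a \<phi>
    using that
  proof (rule apeca_conj_transE)
    fix g\<^sub>1 \<phi>\<^sub>1 g\<^sub>2 \<phi>\<^sub>2
    assume e: "ec_trans E\<^sub>1 (fst l) g\<^sub>1 a \<phi>\<^sub>1 \<noteq> BBot" "ec_trans E\<^sub>2 (snd l) g\<^sub>2 a \<phi>\<^sub>2 \<noteq> BBot"
      and eq: "g = GAnd g\<^sub>1 g\<^sub>2" "\<phi> = constr_conj \<phi>\<^sub>1 \<phi>\<^sub>2"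
    have "\<mu> \<in> Dist (ec_locs E\<^sub>1 \<times> ec_locs E\<^sub>2)" if "\<mu> \<in> \<phi>" for \<mu>
    proof -
      \<comment> \<open>A distribution on pairs lives on the product once both marginals live on the
        factors.\<close>
      have "map_pmf fst \<mu> \<in> Dist (ec_locs E\<^sub>1)" "map_pmf snd \<mu> \<in> Dist (ec_locs E\<^sub>2)"
        using that edge\<^sub>1[OF e(1)] edge\<^sub>2[OF e(2)] by (auto simp: eq constr_conj_def)
      then show ?thesis by (force simp: Dist_def)
    qed
    then show ?thesis
      using edge\<^sub>1[OF e(1)] edge\<^sub>2[OF e(2)] by (auto simp: eq sel clocks CC_def)
  qed
  have "ec_implementations C ?D \<subseteq> ec_implementations C E\<^sub>1"
  proof (rule ec_implementations_projection[where \<pi> = fst, OF assms(1) _ _ wf])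
    fix l g a \<phi>
    assume "ec_trans ?D l g a \<phi> \<noteq> BBot"
    then show "\<exists>g' \<phi>'. ec_trans E\<^sub>1 (fst l) g' a \<phi>' \<noteq> BBot \<and>
        guard_sem (ec_clocks ?D) g \<subseteq> guard_sem (ec_clocks ?D) g' \<and> map_pmf fst ` \<phi> \<subseteq> \<phi>'"
      by (rule apeca_conj_transE) (fastforce simp: guard_sem_GAnd constr_conj_def)
  next
    fix l g\<^sub>1 a \<phi>\<^sub>1 v
    assume l: "l \<in> ec_locs ?D" and e: "ec_trans E\<^sub>1 (fst l) g\<^sub>1 a \<phi>\<^sub>1 = BTop"
      and v: "v \<in> guard_sem (ec_clocks ?D) g\<^sub>1"
    have "a \<in> ec_acts E\<^sub>2" "snd l \<in> ec_locs E\<^sub>2" "v \<in> valuations (ec_clocks E\<^sub>2)"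
      using edge\<^sub>1[of "fst l" g\<^sub>1 a \<phi>\<^sub>1] e l v assms(6) clocks by (auto simp: sel guard_sem_def)
    \<comment> \<open>The partner edge may be a mere may-edge: the join with \<open>BTop\<close>
      still gives a must-edge. Its choice depends on \<open>v\<close>.\<close>
    then obtain g\<^sub>2 \<phi>\<^sub>2 where "ec_trans E\<^sub>2 (snd l) g\<^sub>2 a \<phi>\<^sub>2 \<noteq> BBot" "v \<in> guard_sem (ec_clocks E\<^sub>2) g\<^sub>2"
      using apeca_trans_cover[OF assms(5)] by blast
    then show "\<exists>g \<phi>. ec_trans ?D l g a \<phi> = BTop \<and> v \<in> guard_sem (ec_clocks ?D) g \<and>
        map_pmf fst ` \<phi> \<subseteq> \<phi>\<^sub>1"
      using apeca_conj_trans_top[of E\<^sub>1 "fst l" g\<^sub>1 a \<phi>\<^sub>1 E\<^sub>2 "snd l" g\<^sub>2 \<phi>\<^sub>2] e v clocks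
      by (intro exI[of _ "GAnd g\<^sub>1 g\<^sub>2"] exI[of _ "constr_conj \<phi>\<^sub>1 \<phi>\<^sub>2"])
        (auto simp: guard_sem_GAnd constr_conj_def)
  qed (auto simp: sel)
  moreover have "ec_implementations C ?D \<subseteq> ec_implementations C E\<^sub>2"
  proof (rule ec_implementations_projection[where \<pi> = snd, OF assms(1) _ _ wf])
    fix l g a \<phi>
    assume "ec_trans ?D l g a \<phi> \<noteq> BBot"
    then show "\<exists>g' \<phi>'. ec_trans E\<^sub>2 (snd l) g' a \<phi>' \<noteq> BBot \<and>
        guard_sem (ec_clocks ?D) g \<subseteq> guard_sem (ec_clocks ?D) g' \<and> map_pmf snd ` \<phi> \<subseteq> \<phi>'"
      by (rule apeca_conj_transE) (fastforce simp: guard_sem_GAnd constr_conj_def)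
  next
    fix l g\<^sub>2 a \<phi>\<^sub>2 v
    assume l: "l \<in> ec_locs ?D" and e: "ec_trans E\<^sub>2 (snd l) g\<^sub>2 a \<phi>\<^sub>2 = BTop"
      and v: "v \<in> guard_sem (ec_clocks ?D) g\<^sub>2"
    have "a \<in> ec_acts E\<^sub>1" "fst l \<in> ec_locs E\<^sub>1" "v \<in> valuations (ec_clocks E\<^sub>1)"
      using edge\<^sub>2[of "snd l" g\<^sub>2 a \<phi>\<^sub>2] e l v assms(6) clocks by (auto simp: sel guard_sem_def)
    then obtain g\<^sub>1 \<phi>\<^sub>1 where "ec_trans E\<^sub>1 (fst l) g\<^sub>1 a \<phi>\<^sub>1 \<noteq> BBot" "v \<in> guard_sem (ec_clocks E\<^sub>1) g\<^sub>1"
      using apeca_trans_cover[OF assms(4)] by blast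
    then show "\<exists>g \<phi>. ec_trans ?D l g a \<phi> = BTop \<and> v \<in> guard_sem (ec_clocks ?D) g \<and>
        map_pmf snd ` \<phi> \<subseteq> \<phi>\<^sub>2"
      using apeca_conj_trans_top[of E\<^sub>1 "fst l" g\<^sub>1 a \<phi>\<^sub>1 E\<^sub>2 "snd l" g\<^sub>2 \<phi>\<^sub>2] e v clocks
      by (intro exI[of _ "GAnd g\<^sub>1 g\<^sub>2"] exI[of _ "constr_conj \<phi>\<^sub>1 \<phi>\<^sub>2"])
        (auto simp: guard_sem_GAnd constr_conj_def)
  \<comment> \<open>The conjunction takes its signature from \<open>E\<^sub>1\<close>, so matching
    \<open>E\<^sub>2\<close> uses the assumed equality of actions and propositions.\<close>
  qed (use assms in \<open>auto simp: sel\<close>)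
  ultimately show ?thesis by blast
qed

end
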